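(* Let $p(z)$ be a distribution over text prompts $z$, let $r(x_0,z)$ be a real-valued reward function, and let $p_\theta(x_{0:T}\mid z)$ be a text-conditioned diffusion model with parameter $\theta$. If $p_\theta(x_{0:T}\mid z)\,r(x_0,z)$ and $\nabla_\theta p_\theta(x_{0:T}\mid z)\,r(x_0,z)$ are continuous functions of $\theta$, then $$\nabla_{\theta}\, \mathbb{E}_{p(z)}\mathbb{E}_{p_\theta(x_0\mid z)}\big[-r(x_0,z)\big] = \mathbb{E}_{p(z)}\mathbb{E}_{p_\theta(x_{0:T}\mid z)}\left[-r(x_0,z) \sum_{t=1}^{T} \nabla_{\theta}\log p_{\theta}(x_{t-1}\mid x_{t},z)\right].$$
   Context: Fix a horizon $T\ge 1$ and dimension $n$; $x_0,\dots,x_T\in\mathbb{R}^n$ and $x_{0:T}=(x_0,\dots,x_T)$. The text-conditioned diffusion model is the (reverse-time) Markov chain with joint density $$p_\theta(x_{0:T}\mid z)=p_T(x_T)\prod_{t=1}^T p_\theta(x_{t-1}\mid x_t,z),\qquad p_T=\mathcal{N}(0,I),\qquad p_\theta(x_{t-1}\mid x_t,z)=\mathcal{N}\big(\mu_\theta(x_t,t,z),\Sigma_t\big),$$ where the mean function $\mu_\theta$ depends on the trainable parameter $\theta$ and the covariance matrices $\Sigma_t$ are fixed (not trainable). The marginal is $p_\theta(x_0\mid z)=\int p_\theta(x_{0:T}\mid z)\,dx_{1:T}$. The prompt distribution $p(z)$ and the reward $r$ do not depend on $\theta$.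
   Formalization: Continuity in θ alone does not allow exchanging gradient and expectation (the claim then fails); here the gradient of p_θ(x_{0:T}|z) times r(x_0,z) is also assumed continuous in θ in the L^1 mean over z and x_{0:T}, and the reward is assumed integrable for each θ. *)

theory Defs
  imports "HOL-Probability.Probability"
begin

text \<open>The library has the relation \<^const>\<open>gderiv\<close> (\<open>GDERIV f x :> D\<close>) but no gradient operator.
  \<open>grad f x\<close> is meaningful only where \<open>f\<close> is differentiable.\<close>

definition grad :: "('p::real_inner \<Rightarrow> real) \<Rightarrow> 'p \<Rightarrow> 'p" where
  "grad f x = (THE D. GDERIV f x :> D)"

lemma grad_eq:
  assumes "GDERIV f x :> D"
  shows "grad f x = D"
  unfolding grad_def
proof (rule the_equality)
  show "GDERIV f x :> D" by (fact assms)
next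
  fix D' assume "GDERIV f x :> D'"
  with assms have "(\<lambda>h. h \<bullet> D') = (\<lambda>h. h \<bullet> D)"
    unfolding gderiv_def by (rule has_derivative_unique[rotated])
  then have "\<And>h. h \<bullet> (D' - D) = 0"
    by (metis inner_diff_right right_minus_eq)
  then show "D' = D"
    using inner_eq_zero_iff[of "D' - D"] by simp
qed

definition pos_def_matrix :: "real ^ 'n ^ 'n \<Rightarrow> bool" where
  "pos_def_matrix S \<longleftrightarrow> transpose S = S \<and> (\<forall>v. v \<noteq> 0 \<longrightarrow> v \<bullet> (S *v v) > 0)"

definition gaussian_density :: "real ^ 'n \<Rightarrow> real ^ 'n ^ 'n \<Rightarrow> real ^ 'n \<Rightarrow> real" where
  "gaussian_density m S x =
     exp (- ((x - m) \<bullet> (matrix_inv S *v (x - m))) / 2) / sqrt ((2 * pi) ^ CARD('n) * det S)"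

text \<open>In the following, \<open>\<mu> \<theta> y t z\<close> is the mean of the step from \<open>x\<^sub>t = y\<close> to \<open>x\<^sub>t\<^sub>-\<^sub>1\<close> under the
  prompt \<open>z\<close>, and \<open>\<Sigma>\<^sub>c t\<close> is its covariance.\<close>

definition step_density ::
  "('p \<Rightarrow> real ^ 'n \<Rightarrow> nat \<Rightarrow> 'z \<Rightarrow> real ^ 'n) \<Rightarrow> (nat \<Rightarrow> real ^ 'n ^ 'n) \<Rightarrow>
   'p \<Rightarrow> 'z \<Rightarrow> nat \<Rightarrow> real ^ 'n \<Rightarrow> real ^ 'n \<Rightarrow> real" where
  "step_density \<mu> \<Sigma>\<^sub>c \<theta> z t y x = gaussian_density (\<mu> \<theta> y t z) (\<Sigma>\<^sub>c t) x"

text \<open>A trajectory \<open>x\<^sub>0\<^sub>:\<^sub>T\<close> is a function on \<^typ>\<open>nat\<close>, of which only the values at \<open>0, \<dots>, T\<close> matter;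
  \<open>lebesgue_on_times I\<close> is Lebesgue measure \<open>dx\<^sub>I\<close> on the coordinates with index in \<open>I\<close>.\<close>

definition lebesgue_on_times :: "nat set \<Rightarrow> (nat \<Rightarrow> real ^ 'n) measure" where
  "lebesgue_on_times I = (\<Pi>\<^sub>M t\<in>I. lborel)"

definition traj_density ::
  "nat \<Rightarrow> ('p \<Rightarrow> real ^ 'n \<Rightarrow> nat \<Rightarrow> 'z \<Rightarrow> real ^ 'n) \<Rightarrow> (nat \<Rightarrow> real ^ 'n ^ 'n) \<Rightarrow>
   'p \<Rightarrow> 'z \<Rightarrow> (nat \<Rightarrow> real ^ 'n) \<Rightarrow> real" where
  "traj_density T \<mu> \<Sigma>\<^sub>c \<theta> z x =
     gaussian_density 0 (mat 1) (x T) * (\<Prod>t=1..T. step_density \<mu> \<Sigma>\<^sub>c \<theta> z t (x t) (x (t - 1)))"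

definition traj_law ::
  "nat \<Rightarrow> ('p \<Rightarrow> real ^ 'n \<Rightarrow> nat \<Rightarrow> 'z \<Rightarrow> real ^ 'n) \<Rightarrow> (nat \<Rightarrow> real ^ 'n ^ 'n) \<Rightarrow>
   'p \<Rightarrow> 'z \<Rightarrow> (nat \<Rightarrow> real ^ 'n) measure" where
  "traj_law T \<mu> \<Sigma>\<^sub>c \<theta> z =
     density (lebesgue_on_times {0..T}) (\<lambda>x. ennreal (traj_density T \<mu> \<Sigma>\<^sub>c \<theta> z x))"

definition sample_density ::
  "nat \<Rightarrow> ('p \<Rightarrow> real ^ 'n \<Rightarrow> nat \<Rightarrow> 'z \<Rightarrow> real ^ 'n) \<Rightarrow> (nat \<Rightarrow> real ^ 'n ^ 'n) \<Rightarrow>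
   'p \<Rightarrow> 'z \<Rightarrow> real ^ 'n \<Rightarrow> ennreal" where
  "sample_density T \<mu> \<Sigma>\<^sub>c \<theta> z x\<^sub>0 =
     (\<integral>\<^sup>+x. ennreal (traj_density T \<mu> \<Sigma>\<^sub>c \<theta> z (x(0 := x\<^sub>0))) \<partial>lebesgue_on_times {1..T})"

definition sample_law ::
  "nat \<Rightarrow> ('p \<Rightarrow> real ^ 'n \<Rightarrow> nat \<Rightarrow> 'z \<Rightarrow> real ^ 'n) \<Rightarrow> (nat \<Rightarrow> real ^ 'n ^ 'n) \<Rightarrow>
   'p \<Rightarrow> 'z \<Rightarrow> (real ^ 'n) measure" where
  "sample_law T \<mu> \<Sigma>\<^sub>c \<theta> z = density lborel (sample_density T \<mu> \<Sigma>\<^sub>c \<theta> z)"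

text \<open>Continuity of a parametrised function \<open>F \<theta> = F \<theta> (\<cdot>)\<close> as a map into \<open>L\<^sup>1(M)\<close>. Pointwise
  continuity in \<open>\<theta>\<close> alone does not allow exchanging \<open>\<nabla>\<^sub>\<theta>\<close> with an integral over the unbounded
  trajectory space. Given pointwise continuity, this condition is weaker than the usual one of a
  locally uniform integrable majorant.\<close>

definition L1_continuous ::
  "'w measure \<Rightarrow> ('p::topological_space \<Rightarrow> 'w \<Rightarrow> 'b::{banach, second_countable_topology}) \<Rightarrow> bool"
  where
  "L1_continuous M F \<longleftrightarrow>
     (\<forall>\<theta>. integrable M (F \<theta>)) \<and>
     (\<forall>\<theta>\<^sub>0. ((\<lambda>\<theta>. \<integral>w. norm (F \<theta> w - F \<theta>\<^sub>0 w) \<partial>M) \<longlongrightarrow> 0) (at \<theta>\<^sub>0))"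

end

(* The differentiation formula for integrals holds because the gradients G depend continuously on
   the parameter in L^1: by the fundamental theorem of calculus along the segment from a to a + h
   and Tonelli, the L^1 norm of the first-order Taylor remainder is at most
   |h| sup_{0 <= s <= 1} ||G (a + s h) - G a||_1, which is o(|h|). It is applied once, to
   p_theta(x_{0:T} | z) r(x_0, z) on the product of the prompt and trajectory spaces. Fubini
   rewrites both sides of the claim as integrals over that product, and the factors of
   p_theta being positive (Gaussian), its gradient is p_theta times the sum of the gradients of
   the logarithms of the factors. *)

theory Submission
  imports Defs
begin

section \<open>Gradients\<close>

text \<open>Riesz representation in finite dimension: a linear functional \<open>L\<close> is the
  inner product with the vector whose coordinates are its values on the orthonormal
  \<open>Basis\<close>. This existence is what gives the definite description in \<open>grad\<close>
  a meaning.\<close>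

lemma GDERIV_grad:
  fixes f :: "'p::euclidean_space \<Rightarrow> real"
  assumes "f differentiable (at x)"
  shows "GDERIV f x :> grad f x"
proof -
  obtain L where L: "(f has_derivative L) (at x)"
    using assms by (auto simp: differentiable_def)
  then interpret bounded_linear L
    by (rule has_derivative_bounded_linear)
  have "L h = h \<bullet> (\<Sum>b\<in>Basis. L b *\<^sub>R b)" for h
  proof -
    have "L h = L (\<Sum>b\<in>Basis. (h \<bullet> b) *\<^sub>R b)"
      by (simp add: euclidean_representation)
    also have "\<dots> = (\<Sum>b\<in>Basis. (h \<bullet> b) * L b)"
      by (simp add: sum scaleR)
    finally show ?thesis
      by (simp add: inner_sum_right mult.commute)
  qed
  then have "L = (\<lambda>h. h \<bullet> (\<Sum>b\<in>Basis. L b *\<^sub>R b))"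
    by blast
  with L have "GDERIV f x :> (\<Sum>b\<in>Basis. L b *\<^sub>R b)"
    by (simp add: gderiv_def)
  then show ?thesis
    by (simp add: grad_eq)
qed

lemma GDERIV_along_segment:
  assumes "GDERIV f (a + s *\<^sub>R h) :> D"
  shows "((\<lambda>s. f (a + s *\<^sub>R h)) has_vector_derivative h \<bullet> D) (at s within S)"
proof -
  have "((\<lambda>s. a + s *\<^sub>R h) has_derivative (\<lambda>u. u *\<^sub>R h)) (at s within S)"
    by (auto intro!: derivative_eq_intros)
  moreover have "(f has_derivative (\<lambda>h. h \<bullet> D)) (at (a + s *\<^sub>R h))"
    using assms by (simp add: gderiv_def)
  ultimately have "((\<lambda>s. f (a + s *\<^sub>R h)) has_derivative (\<lambda>u. (u *\<^sub>R h) \<bullet> D)) (at s within S)"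
    by (rule has_derivative_compose)
  then show ?thesis
    by (simp add: has_vector_derivative_def)
qed

text \<open>Logarithmic differentiation: positivity of the factors at every point, not only at the
  point of differentiation, makes the product equal to the exponential of the sum of logarithms as a
  function, and the chain rule applies to that. The constant \<open>c\<close> leaves room for a
  factor that does not depend on the parameter.\<close>

lemma score_identity:
  fixes f :: "'i \<Rightarrow> 'p::euclidean_space \<Rightarrow> real"
  assumes pos: "\<And>i x. i \<in> I \<Longrightarrow> 0 < f i x"
    and diff: "\<And>i. i \<in> I \<Longrightarrow> f i differentiable (at x)"
  shows "GDERIV (\<lambda>x. c * (\<Prod>i\<in>I. f i x)) x :>
    (c * (\<Prod>i\<in>I. f i x)) *\<^sub>R (\<Sum>i\<in>I. grad (\<lambda>x. ln (f i x)) x)"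
proof (cases "finite I")
  case True
  have prod_eq: "(\<Prod>i\<in>I. f i x) = exp (\<Sum>i\<in>I. ln (f i x))" for x
    using pos by (simp add: exp_sum True)
  have "((\<lambda>x. ln (f i x)) has_derivative (\<lambda>h. h \<bullet> grad (\<lambda>x. ln (f i x)) x)) (at x)"
    if i: "i \<in> I" for i
  proof -
    obtain L where "(f i has_derivative L) (at x)"
      using diff[OF i] by (auto simp: differentiable_def)
    then have "((\<lambda>x. ln (f i x)) has_derivative (\<lambda>h. L h * inverse (f i x))) (at x)"
      using pos[OF i] by (auto intro!: derivative_eq_intros simp: field_simps)
    then have "(\<lambda>x. ln (f i x)) differentiable (at x)"
      by (auto simp: differentiable_def)
    then show ?thesis
      using GDERIV_grad by (auto simp: gderiv_def)
  qed
  then have "((\<lambda>x. \<Sum>i\<in>I. ln (f i x)) has_derivative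
      (\<lambda>h. \<Sum>i\<in>I. h \<bullet> grad (\<lambda>x. ln (f i x)) x)) (at x)"
    by (rule has_derivative_sum)
  from has_derivative_mult_right[OF has_derivative_exp[OF this], of c] show ?thesis
    unfolding gderiv_def prod_eq by (simp add: inner_sum_right mult_ac)
\<comment> \<open>For infinite \<open>I\<close> the product defaults to 1 and the sum to 0, so the
  claim is that a constant has gradient 0.\<close>
qed (simp add: gderiv_def)

section \<open>Differentiation under the integral sign\<close>

text \<open>Rounding \<open>s\<close> down to the grid of mesh 1/n gives jointly measurable
  functions, which converge pointwise to \<open>g\<close> by continuity in \<open>s\<close>. Joint
  measurability is what Tonelli requires in the Taylor estimate.\<close>

lemma borel_measurable_Caratheodory:
  fixes g :: "real \<Rightarrow> 'w \<Rightarrow> 'b::metric_space"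
  assumes meas: "\<And>s. g s \<in> borel_measurable N"
    and cont: "\<And>w. w \<in> space N \<Longrightarrow> continuous_on UNIV (\<lambda>s. g s w)"
  shows "(\<lambda>(s, w). g s w) \<in> borel_measurable (borel \<Otimes>\<^sub>M N)"
proof (rule borel_measurable_LIMSEQ_metric)
  \<comment> \<open>The grid index is a measurable integer, so this function is glued from countably
    many functions that are measurable in \<open>w\<close> alone.\<close>
  show "(\<lambda>(s, w). g (of_int \<lfloor>real n * s\<rfloor> / real n) w) \<in> borel_measurable (borel \<Otimes>\<^sub>M N)" for n
    unfolding case_prod_beta
    by (rule measurable_compose_countable[where f="\<lambda>i p. g (of_int i / real n) (snd p)"
          and g="\<lambda>p. \<lfloor>real n * fst p\<rfloor>"])
       (use meas in measurable)
next
  fix p :: "real \<times> 'w" assume "p \<in> space (borel \<Otimes>\<^sub>M N)"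
  then obtain s :: real and w where p: "p = (s, w)" "w \<in> space N"
    by (auto simp: space_pair_measure)
  have lim: "(\<lambda>n. of_int \<lfloor>real n * s\<rfloor> / real n) \<longlonglongrightarrow> s"
  proof (rule tendsto_sandwich)
    \<comment> \<open>The bounds hold only eventually: at \<open>n = 0\<close> division by zero
      yields 0.\<close>
    show "\<forall>\<^sub>F n in sequentially. s - 1 / real n \<le> of_int \<lfloor>real n * s\<rfloor> / real n"
      using eventually_gt_at_top[of 0]
    proof eventually_elim
      case (elim n)
      have "(real n * s - 1) / real n \<le> of_int \<lfloor>real n * s\<rfloor> / real n"
        by (rule divide_right_mono) linarith+
      with elim show ?case
        by (simp add: diff_divide_distrib)
    qed
    show "\<forall>\<^sub>F n in sequentially. of_int \<lfloor>real n * s\<rfloor> / real n \<le> s"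
      using eventually_gt_at_top[of 0]
      by eventually_elim (simp add: field_simps)
    show "(\<lambda>n. s - 1 / real n) \<longlonglongrightarrow> s"
      using tendsto_diff[OF tendsto_const lim_1_over_n, of s] by simp
  qed simp
  show "(\<lambda>n. case p of (s, w) \<Rightarrow> g (of_int \<lfloor>real n * s\<rfloor> / real n) w) \<longlonglongrightarrow>
      (case p of (s, w) \<Rightarrow> g s w)"
    using continuous_on_tendsto_compose[OF cont[OF p(2)] lim] by (simp add: p(1))
qed

text \<open>The remainder is the integral over \<open>s\<close> in [0,1] of the inner product of
  \<open>h\<close> with \<open>G (a + s h) - G a\<close>. After Tonelli, \<open>bound\<close> is
  applied for each \<open>s\<close> separately, so no integrable majorant uniform in
  \<open>s\<close> is involved.\<close>

lemma L1_Taylor_bound: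
  fixes f :: "'p::euclidean_space \<Rightarrow> 'w \<Rightarrow> real"
  assumes "sigma_finite_measure N"
    and f: "\<And>x. integrable N (f x)"
    and G: "\<And>x. integrable N (G x)"
    and deriv: "\<And>x w. w \<in> space N \<Longrightarrow> GDERIV (\<lambda>x. f x w) x :> G x w"
    and cont: "\<And>w. w \<in> space N \<Longrightarrow> continuous_on UNIV (\<lambda>x. G x w)"
    and bound: "\<And>s. 0 \<le> s \<Longrightarrow> s \<le> 1 \<Longrightarrow> (\<integral>w. norm (G (a + s *\<^sub>R h) w - G a w) \<partial>N) \<le> e"
  shows "\<bar>(\<integral>w. f (a + h) w \<partial>N) - (\<integral>w. f a w \<partial>N) - h \<bullet> (\<integral>w. G a w \<partial>N)\<bar> \<le> norm h * e"
proof -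
  interpret sigma_finite_measure N by fact
  interpret P: pair_sigma_finite lborel N ..
  have e: "0 \<le> e"
    using bound[of 0] by simp
  define R where "R w = f (a + h) w - f a w - h \<bullet> G a w" for w
  define g where "g s w = G (a + s *\<^sub>R h) w - G a w" for s :: real and w
  have g_cont: "continuous_on UNIV (\<lambda>s. g s w)" if "w \<in> space N" for w
    unfolding g_def
    by (intro continuous_intros continuous_on_compose2[OF cont[OF that]]) auto
  have g_meas: "g s \<in> borel_measurable N" for s
    unfolding g_def using G by auto
  have joint: "(\<lambda>p. g (fst p) (snd p)) \<in> borel_measurable (lborel \<Otimes>\<^sub>M N)"
    using borel_measurable_Caratheodory[OF g_meas g_cont]
    by (simp add: case_prod_beta cong: measurable_cong_sets)
  have R_int: "integrable N R"
    unfolding R_def using f G by (intro Bochner_Integration.integrable_diff integrable_inner_right) auto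
  have R_le: "ennreal (norm (R w)) \<le>
      (\<integral>\<^sup>+s. ennreal (norm h * norm (g s w)) * indicator {0..1} s \<partial>lborel)"
    if w: "w \<in> space N" for w
  proof -
    \<comment> \<open>Subtracting the linear term before differentiating makes the increment over
      [0,1] exactly the remainder \<open>R w\<close>.\<close>
    have "((\<lambda>s. f (a + s *\<^sub>R h) w - s * (h \<bullet> G a w)) has_vector_derivative h \<bullet> g s w)
        (at s within {0..1})" for s :: real
    proof -
      have "((\<lambda>s. s * (h \<bullet> G a w)) has_vector_derivative h \<bullet> G a w) (at s within {0..1})"
        by (auto intro!: derivative_eq_intros)
      from has_vector_derivative_diff[OF GDERIV_along_segment[OF deriv[OF w]] this] show ?thesis
        by (simp add: g_def inner_diff_right)
    qed
    moreover have "continuous_on {0..1} (\<lambda>s. h \<bullet> g s w)"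
      by (intro continuous_intros continuous_on_subset[OF g_cont[OF w]]) simp
    ultimately have "(\<integral>s. indicator {0..1} s *\<^sub>R (h \<bullet> g s w) \<partial>lborel) = R w"
      by (subst integral_FTC_atLeastAtMost[where F="\<lambda>s. f (a + s *\<^sub>R h) w - s * (h \<bullet> G a w)"])
         (auto simp: R_def)
    \<comment> \<open>No integrability in \<open>s\<close> has to be checked: a function that is not
      integrable has integral 0, and the bound is then trivial.\<close>
    then have "ennreal (norm (R w)) \<le>
        (\<integral>\<^sup>+s. norm (indicator {0..1} s *\<^sub>R (h \<bullet> g s w)) \<partial>lborel)"
      by (metis integral_norm_bound_ennreal not_integrable_integral_eq norm_zero ennreal_0 zero_le)
    also have "\<dots> \<le> (\<integral>\<^sup>+s. ennreal (norm h * norm (g s w)) * indicator {0..1} s \<partial>lborel)"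
      by (intro nn_integral_mono) (auto simp: indicator_def Cauchy_Schwarz_ineq2 intro!: ennreal_leI)
    finally show ?thesis .
  qed
  have "\<bar>(\<integral>w. R w \<partial>N)\<bar> \<le> norm h * e"
  proof -
    have "ennreal (norm (\<integral>w. R w \<partial>N)) \<le> (\<integral>\<^sup>+w. ennreal (norm (R w)) \<partial>N)"
      by (rule integral_norm_bound_ennreal[OF R_int])
    also have "\<dots> \<le> (\<integral>\<^sup>+w. (\<integral>\<^sup>+s. ennreal (norm h * norm (g s w)) * indicator {0..1} s \<partial>lborel) \<partial>N)"
      by (intro nn_integral_mono R_le)
    also have "\<dots> = (\<integral>\<^sup>+s. (\<integral>\<^sup>+w. ennreal (norm h * norm (g s w)) * indicator {0..1} s \<partial>N) \<partial>lborel)"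
      by (rule P.Fubini') (use joint in \<open>simp add: case_prod_beta\<close>)
    \<comment> \<open>The indicator confines \<open>s\<close> to [0,1], the only range where
      \<open>bound\<close> is available.\<close>
    also have "\<dots> \<le> (\<integral>\<^sup>+s. ennreal (norm h * e) * indicator {0..1::real} s \<partial>lborel)"
    proof (rule nn_integral_mono)
      fix s :: real
      have "(\<integral>\<^sup>+w. ennreal (norm h * norm (g s w)) \<partial>N) = ennreal (norm h * (\<integral>w. norm (g s w) \<partial>N))"
        using G by (subst nn_integral_eq_integral) (auto simp: g_def)
      then show "(\<integral>\<^sup>+w. ennreal (norm h * norm (g s w)) * indicator {0..1} s \<partial>N)
          \<le> ennreal (norm h * e) * indicator {0..1} s"
        using bound[of s] by (auto simp: indicator_def g_def intro!: ennreal_leI mult_left_mono)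
    qed
    also have "\<dots> = ennreal (norm h * e)"
      by (simp add: nn_integral_cmult_indicator)
    finally show ?thesis
      using e by (simp add: ennreal_le_iff)
  qed
  moreover have "(\<integral>w. R w \<partial>N) = (\<integral>w. f (a + h) w \<partial>N) - (\<integral>w. f a w \<partial>N) - h \<bullet> (\<integral>w. G a w \<partial>N)"
    unfolding R_def using f G by (simp add: Bochner_Integration.integral_diff)
  ultimately show ?thesis
    by simp
qed

text \<open>\<open>L1_continuous\<close> makes the constant of the Taylor bound as small as desired
  on a ball around \<open>a\<close>. A ball contains the segment from its centre to each of its
  points, so the remainder is at most \<open>e\<close> times the length of the increment.\<close>

lemma GDERIV_integral:
  fixes f :: "'p::euclidean_space \<Rightarrow> 'w \<Rightarrow> real"
  assumes sf: "sigma_finite_measure N"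
    and f: "\<And>x. integrable N (f x)"
    and deriv: "\<And>x w. w \<in> space N \<Longrightarrow> GDERIV (\<lambda>x. f x w) x :> G x w"
    and cont: "\<And>w. w \<in> space N \<Longrightarrow> continuous_on UNIV (\<lambda>x. G x w)"
    and L1: "L1_continuous N G"
  shows "GDERIV (\<lambda>x. \<integral>w. f x w \<partial>N) a :> (\<integral>w. G a w \<partial>N)"
  unfolding gderiv_def has_derivative_at_alt
proof (intro conjI allI impI)
  show "bounded_linear (\<lambda>h. h \<bullet> (\<integral>w. G a w \<partial>N))"
    by (rule bounded_linear_inner_left)
  fix e :: real assume e: "0 < e"
  have G: "integrable N (G x)" for x
    using L1 by (simp add: L1_continuous_def)
  have "((\<lambda>x. \<integral>w. norm (G x w - G a w) \<partial>N) \<longlongrightarrow> 0) (at a)"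
    using L1 by (simp add: L1_continuous_def)
  from tendstoD[OF this e] obtain d where d: "0 < d"
    "\<And>x. x \<noteq> a \<Longrightarrow> dist x a < d \<Longrightarrow> \<bar>\<integral>w. norm (G x w - G a w) \<partial>N\<bar> < e"
    unfolding eventually_at by auto
  show "\<exists>d>0. \<forall>y. norm (y - a) < d \<longrightarrow>
      norm ((\<integral>w. f y w \<partial>N) - (\<integral>w. f a w \<partial>N) - (y - a) \<bullet> (\<integral>w. G a w \<partial>N)) \<le> e * norm (y - a)"
  proof (intro exI[of _ d] conjI allI impI d(1))
    fix y assume y: "norm (y - a) < d"
    have "(\<integral>w. norm (G (a + s *\<^sub>R (y - a)) w - G a w) \<partial>N) \<le> e" if "0 \<le> s" "s \<le> 1" for s
    \<comment> \<open>The limit at \<open>a\<close> says nothing about \<open>a\<close> itself, so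
      this point is treated apart; there the integrand vanishes.\<close>
    proof (cases "a + s *\<^sub>R (y - a) = a")
      case False
      have "s * norm (y - a) \<le> norm (y - a)"
        using that by (simp add: mult_left_le_one_le)
      with y that have "dist (a + s *\<^sub>R (y - a)) a < d"
        by (simp add: dist_norm)
      from d(2)[OF False this] show ?thesis
        by simp
    next
      case True
      then show ?thesis
        using e by (simp only: True) simp
    qed
    from L1_Taylor_bound[OF sf f G deriv cont this]
    show "norm ((\<integral>w. f y w \<partial>N) - (\<integral>w. f a w \<partial>N) - (y - a) \<bullet> (\<integral>w. G a w \<partial>N)) \<le> e * norm (y - a)"
      by (simp add: mult.commute)
  qed
qed

section \<open>Gaussian densities\<close>

text \<open>The determinant does not vanish on the segment of positive definite matrices from the
  identity to \<open>S\<close>.\<close>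

lemma det_pos_def_matrix:
  fixes S :: "real ^ 'n ^ 'n"
  assumes "pos_def_matrix S"
  shows "0 < det S"
proof (rule ccontr)
  define A where "A s = (1 - s) *\<^sub>R mat 1 + s *\<^sub>R S" for s :: real
  assume "\<not> 0 < det S"
  then have "det (A 1) \<le> 0" "0 \<le> det (A 0)"
    by (simp_all add: A_def)
  moreover have "continuous_on {0..1} (\<lambda>s. det (A s))"
    unfolding det_def A_def by (intro continuous_intros)
  ultimately obtain s where s: "0 \<le> s" "s \<le> 1" "det (A s) = 0"
    using IVT2'[of "\<lambda>s. det (A s)" 1 0 0] by auto
  then have "\<not> invertible (A s)"
    by (simp add: invertible_det_nz)
  then obtain v where v: "v \<noteq> 0" "A s *v v = 0"
    unfolding invertible_left_inverse matrix_left_invertible_ker by auto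
  \<comment> \<open>On a kernel vector this quadratic form is 0, yet it is a convex combination of
    two positive numbers. The case \<open>s = 0\<close> is separate below because only the first
    summand is then positive.\<close>
  have "v \<bullet> (A s *v v) = (1 - s) * (v \<bullet> v) + s * (v \<bullet> (S *v v))"
    by (simp add: A_def matrix_vector_mult_add_rdistrib scaleR_matrix_vector_assoc[symmetric]
        inner_add_right)
  moreover have "0 < v \<bullet> (S *v v)" "0 < v \<bullet> v"
    using assms v(1) by (auto simp: pos_def_matrix_def)
  then have "0 < (1 - s) * (v \<bullet> v) + s * (v \<bullet> (S *v v))"
    using s(1,2) by (cases "s = 0") (auto intro: add_nonneg_pos)
  ultimately show False
    using v(2) by simp
qed

lemma gaussian_density_pos:
  assumes "0 < det S"
  shows "0 < gaussian_density m S x"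
  using assms by (simp add: gaussian_density_def)

text \<open>The mean varies together with the argument, because in the model it is a function of the
  state conditioned on.\<close>

lemma borel_measurable_gaussian_density [measurable (raw)]:
  fixes m x :: "'w \<Rightarrow> real ^ 'n"
  assumes [measurable]: "m \<in> borel_measurable M" "x \<in> borel_measurable M"
  shows "(\<lambda>w. gaussian_density (m w) S (x w)) \<in> borel_measurable M"
proof -
  have [measurable]: "(\<lambda>v. matrix_inv S *v v) \<in> borel_measurable borel"
    by (intro borel_measurable_continuous_onI matrix_vector_mult_linear_continuous_on)
  show ?thesis
    unfolding gaussian_density_def by measurable
qed

section \<open>The diffusion model\<close>

lemma sigma_finite_lebesgue_on_times:
  "finite I \<Longrightarrow> sigma_finite_measure (lebesgue_on_times I :: (nat \<Rightarrow> real ^ 'n) measure)"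
  unfolding lebesgue_on_times_def
  by (intro product_sigma_finite.sigma_finite product_sigma_finite.intro sigma_finite_lborel)

text \<open>Positive definite covariances have positive determinants, so every Gaussian factor is
  positive. Strictness matters: the score is recovered later by dividing by this density.\<close>

lemma traj_density_pos:
  assumes "\<And>t. t \<in> {1..T} \<Longrightarrow> pos_def_matrix (\<Sigma>\<^sub>c t)"
  shows "0 < traj_density T \<mu> \<Sigma>\<^sub>c \<theta> z x"
  unfolding traj_density_def step_density_def
  using assms by (intro mult_pos_pos prod_pos gaussian_density_pos ballI) (auto simp: det_pos_def_matrix)

lemma borel_measurable_traj_density:
  assumes [measurable]: "\<And>t. t \<in> {1..T} \<Longrightarrow> (\<lambda>x. \<mu> \<theta> x t z) \<in> borel_measurable borel"
  shows "traj_density T \<mu> \<Sigma>\<^sub>c \<theta> z \<in> borel_measurable (lebesgue_on_times {0..T})"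
proof -
  have comp: "(\<lambda>x. x t) \<in> borel_measurable (lebesgue_on_times {0..T})" if "t \<le> T" for t
    using measurable_component_singleton[of t "{0..T}" "\<lambda>_. lborel"] that
    by (simp add: lebesgue_on_times_def)
  show ?thesis
    unfolding traj_density_def step_density_def
    by (intro borel_measurable_times borel_measurable_prod borel_measurable_gaussian_density
        measurable_compose[OF comp assms] comp) auto
qed

text \<open>Integrating out the coordinates 1 to \<open>T\<close> is the same as pushing forward
  along the projection to coordinate 0, by Tonelli. This turns expectations over the sample into
  expectations over the trajectory.\<close>

lemma sample_law_eq_distr:
  fixes \<mu> :: "'p \<Rightarrow> real ^ 'n \<Rightarrow> nat \<Rightarrow> 'z \<Rightarrow> real ^ 'n"
  assumes meas: "traj_density T \<mu> \<Sigma>\<^sub>c \<theta> z \<in> borel_measurable (lebesgue_on_times {0..T})"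
  shows "sample_law T \<mu> \<Sigma>\<^sub>c \<theta> z = distr (traj_law T \<mu> \<Sigma>\<^sub>c \<theta> z) lborel (\<lambda>x. x 0)"
proof (rule measure_eqI)
  let ?p = "\<lambda>x. ennreal (traj_density T \<mu> \<Sigma>\<^sub>c \<theta> z x)"
  interpret product_sigma_finite "\<lambda>_::nat. lborel :: (real ^ 'n) measure"
    by standard
  interpret I: sigma_finite_measure "lebesgue_on_times {1..T} :: (nat \<Rightarrow> real ^ 'n) measure"
    by (rule sigma_finite_lebesgue_on_times) simp
  have ins: "insert 0 {1..T} = {0..T}"
    by auto
  have proj [measurable]: "(\<lambda>x. x 0) \<in> lebesgue_on_times {0..T} \<rightarrow>\<^sub>M (borel :: (real ^ 'n) measure)"
    using measurable_component_singleton[of 0 "{0..T}" "\<lambda>_. lborel :: (real ^ 'n) measure"]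
    by (simp add: lebesgue_on_times_def)
  note [measurable] = meas
  \<comment> \<open>Joint measurability of reassembling a trajectory from its two parts is what
    makes the marginal density measurable.\<close>
  have "(\<lambda>p. (snd p)(0 := fst p)) \<in>
      (lborel \<Otimes>\<^sub>M lebesgue_on_times {1..T}) \<rightarrow>\<^sub>M (lebesgue_on_times {0..T} :: (nat \<Rightarrow> real ^ 'n) measure)"
    unfolding lebesgue_on_times_def ins[symmetric] by measurable
  from measurable_compose[OF this meas]
  have upd: "(\<lambda>p. ?p ((snd p)(0 := fst p))) \<in> borel_measurable (lborel \<Otimes>\<^sub>M lebesgue_on_times {1..T})"
    by measurable
  then have sd [measurable]: "sample_density T \<mu> \<Sigma>\<^sub>c \<theta> z \<in> borel_measurable lborel"
    unfolding sample_density_def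
    by (intro I.borel_measurable_nn_integral) (simp add: case_prod_beta)
  show "sets (sample_law T \<mu> \<Sigma>\<^sub>c \<theta> z) = sets (distr (traj_law T \<mu> \<Sigma>\<^sub>c \<theta> z) lborel (\<lambda>x. x 0))"
    by (simp add: sample_law_def)
  fix A assume "A \<in> sets (sample_law T \<mu> \<Sigma>\<^sub>c \<theta> z)"
  then have A [measurable]: "A \<in> sets borel"
    by (simp add: sample_law_def)
  have "emeasure (distr (traj_law T \<mu> \<Sigma>\<^sub>c \<theta> z) lborel (\<lambda>x. x 0)) A =
      (\<integral>\<^sup>+x. indicator A (x 0) \<partial>traj_law T \<mu> \<Sigma>\<^sub>c \<theta> z)"
    by (subst nn_integral_indicator[symmetric], simp, subst nn_integral_distr)
       (auto simp: traj_law_def)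
  also have "\<dots> = (\<integral>\<^sup>+x. ?p x * indicator A (x 0) \<partial>lebesgue_on_times {0..T})"
    unfolding traj_law_def by (rule nn_integral_density) measurable
  \<comment> \<open>Coordinate 0 is split off the product measure; in the inner integral the
    indicator is then constant and can be pulled out.\<close>
  also have "\<dots> = (\<integral>\<^sup>+x\<^sub>0. (\<integral>\<^sup>+x. ?p (x(0 := x\<^sub>0)) * indicator A x\<^sub>0 \<partial>lebesgue_on_times {1..T}) \<partial>lborel)"
  proof -
    have "(\<lambda>x. ?p x * indicator A (x 0)) \<in> borel_measurable (lebesgue_on_times {0..T})"
      by measurable
    then show ?thesis
      using product_nn_integral_insert_rev[of "{1..T}" 0 "\<lambda>x. ?p x * indicator A (x 0)"]
      unfolding lebesgue_on_times_def ins by simp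
  qed
  also have "\<dots> = (\<integral>\<^sup>+x\<^sub>0. sample_density T \<mu> \<Sigma>\<^sub>c \<theta> z x\<^sub>0 * indicator A x\<^sub>0 \<partial>lborel)"
  proof (rule nn_integral_cong)
    fix x\<^sub>0 :: "real ^ 'n"
    show "(\<integral>\<^sup>+x. ?p (x(0 := x\<^sub>0)) * indicator A x\<^sub>0 \<partial>lebesgue_on_times {1..T})
        = sample_density T \<mu> \<Sigma>\<^sub>c \<theta> z x\<^sub>0 * indicator A x\<^sub>0"
      by (cases "x\<^sub>0 \<in> A") (simp_all add: sample_density_def)
  qed
  also have "\<dots> = emeasure (sample_law T \<mu> \<Sigma>\<^sub>c \<theta> z) A"
    unfolding sample_law_def using A by (subst emeasure_density) auto
  finally show "emeasure (sample_law T \<mu> \<Sigma>\<^sub>c \<theta> z) A =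
      emeasure (distr (traj_law T \<mu> \<Sigma>\<^sub>c \<theta> z) lborel (\<lambda>x. x 0)) A" ..
qed

text \<open>\<open>GDERIV\<close> asserts differentiability of the expected reward together with the
  value of its gradient, which an equation between \<open>grad\<close> terms would not. Pointwise
  continuity of the gradient serves the fundamental theorem of calculus on segments; continuity in
  L^1 controls the remainder.\<close>

theorem lemma4p1:
  fixes T :: nat
    and Z :: "'z measure"
    and r :: "real ^ 'n \<Rightarrow> 'z \<Rightarrow> real"
    and \<mu> :: "'p::euclidean_space \<Rightarrow> real ^ 'n \<Rightarrow> nat \<Rightarrow> 'z \<Rightarrow> real ^ 'n"
    and \<Sigma>\<^sub>c :: "nat \<Rightarrow> real ^ 'n ^ 'n"
  assumes horizon: "T \<ge> 1"
    and prompts: "prob_space Z"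
    and covariance: "\<And>t. t \<in> {1..T} \<Longrightarrow> pos_def_matrix (\<Sigma>\<^sub>c t)"
    and mean_measurable:
      "\<And>\<theta> t. t \<in> {1..T} \<Longrightarrow> (\<lambda>(x, z). \<mu> \<theta> x t z) \<in> borel_measurable (borel \<Otimes>\<^sub>M Z)"
    and reward_measurable: "(\<lambda>(x, z). r x z) \<in> borel_measurable (borel \<Otimes>\<^sub>M Z)"
    and step_differentiable:
      "\<And>\<theta> z t y x. z \<in> space Z \<Longrightarrow> t \<in> {1..T} \<Longrightarrow>
         (\<lambda>\<theta>'. step_density \<mu> \<Sigma>\<^sub>c \<theta>' z t y x) differentiable (at \<theta>)"
    and reward_integrable:
      "\<And>\<theta>. integrable (Z \<Otimes>\<^sub>M lebesgue_on_times {0..T})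
         (\<lambda>(z, x). traj_density T \<mu> \<Sigma>\<^sub>c \<theta> z x * r (x 0) z)"
    and continuous:
      "\<And>z x. z \<in> space Z \<Longrightarrow>
         continuous_on UNIV (\<lambda>\<theta>. traj_density T \<mu> \<Sigma>\<^sub>c \<theta> z x * r (x 0) z)"
    and grad_continuous:
      "\<And>z x. z \<in> space Z \<Longrightarrow>
         continuous_on UNIV
           (\<lambda>\<theta>. r (x 0) z *\<^sub>R grad (\<lambda>\<theta>'. traj_density T \<mu> \<Sigma>\<^sub>c \<theta>' z x) \<theta>)"
    and grad_L1_continuous:
      "L1_continuous (Z \<Otimes>\<^sub>M lebesgue_on_times {0..T})
         (\<lambda>\<theta> (z, x). r (x 0) z *\<^sub>R grad (\<lambda>\<theta>'. traj_density T \<mu> \<Sigma>\<^sub>c \<theta>' z x) \<theta>)"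
  shows "\<forall>\<theta>. GDERIV (\<lambda>\<theta>'. \<integral>z. (\<integral>x\<^sub>0. - r x\<^sub>0 z \<partial>sample_law T \<mu> \<Sigma>\<^sub>c \<theta>' z) \<partial>Z) \<theta> :>
           (\<integral>z. (\<integral>x. (- r (x 0) z) *\<^sub>R
                (\<Sum>t=1..T. grad (\<lambda>\<theta>'. ln (step_density \<mu> \<Sigma>\<^sub>c \<theta>' z t (x t) (x (t - 1)))) \<theta>)
              \<partial>traj_law T \<mu> \<Sigma>\<^sub>c \<theta> z) \<partial>Z)"
proof
  fix \<theta>
  interpret Z: prob_space Z by fact
  let ?M = "lebesgue_on_times {0..T} :: (nat \<Rightarrow> real ^ 'n) measure"
  interpret M: sigma_finite_measure ?M
    by (rule sigma_finite_lebesgue_on_times) simp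
  interpret P: pair_sigma_finite Z ?M ..
  let ?p = "traj_density T \<mu> \<Sigma>\<^sub>c"
  \<comment> \<open>Functions on pairs allow both expectations to be differentiated at once. The
    minus sign is left out here and restored in \<open>lhs\<close> and \<open>rhs\<close>.\<close>
  define f where "f \<theta> w = (case w of (z, x) \<Rightarrow> ?p \<theta> z x * r (x 0) z)" for \<theta> w
  define G where "G \<theta> w = (case w of (z, x) \<Rightarrow> r (x 0) z *\<^sub>R grad (\<lambda>\<theta>'. ?p \<theta>' z x) \<theta>)" for \<theta> w
  let ?S = "\<lambda>\<theta> z x. \<Sum>t=1..T. grad (\<lambda>\<theta>'. ln (step_density \<mu> \<Sigma>\<^sub>c \<theta>' z t (x t) (x (t - 1)))) \<theta>"
  note p_pos = traj_density_pos[of T \<Sigma>\<^sub>c, OF covariance]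
  \<comment> \<open>The density of the initial noise \<open>x T\<close> does not depend on \<theta>
    and takes the place of the constant \<open>c\<close>.\<close>
  have score: "GDERIV (\<lambda>\<theta>'. ?p \<theta>' z x) \<theta> :> ?p \<theta> z x *\<^sub>R ?S \<theta> z x"
    if "z \<in> space Z" for \<theta> z x
    unfolding traj_density_def
  proof (rule score_identity)
    show "0 < step_density \<mu> \<Sigma>\<^sub>c \<theta>' z t (x t) (x (t - 1))" if "t \<in> {1..T}" for t \<theta>'
      using covariance[OF that] by (simp add: step_density_def gaussian_density_pos det_pos_def_matrix)
  qed (rule step_differentiable[OF that])
  note p_grad = grad_eq[OF score]
  have G_eq: "G \<theta> (z, x) = ?p \<theta> z x *\<^sub>R r (x 0) z *\<^sub>R ?S \<theta> z x" if "z \<in> space Z" for \<theta> z x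
    by (simp add: G_def p_grad[OF that] mult.commute)
  have G_L1: "L1_continuous (Z \<Otimes>\<^sub>M ?M) G"
    using grad_L1_continuous by (simp add: G_def[abs_def])
  have G_int: "integrable (Z \<Otimes>\<^sub>M ?M) (G \<theta>)" for \<theta>
    using G_L1 by (simp add: L1_continuous_def)
  have f_int: "integrable (Z \<Otimes>\<^sub>M ?M) (f \<theta>)" for \<theta>
    using reward_integrable by (simp add: f_def[abs_def])
  have deriv: "GDERIV (\<lambda>\<theta>. \<integral>w. f \<theta> w \<partial>(Z \<Otimes>\<^sub>M ?M)) \<theta> :> (\<integral>w. G \<theta> w \<partial>(Z \<Otimes>\<^sub>M ?M))"
  proof (rule GDERIV_integral[OF P.sigma_finite_measure_axioms f_int _ _ G_L1])
    fix w assume "w \<in> space (Z \<Otimes>\<^sub>M ?M)"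
    then obtain z x where w: "w = (z, x)" "z \<in> space Z"
      by (auto simp: space_pair_measure)
    show "GDERIV (\<lambda>\<theta>. f \<theta> w) \<theta> :> G \<theta> w" for \<theta>
      using has_derivative_mult_left[OF score[OF w(2), unfolded gderiv_def], where y="r (x 0) z"]
      unfolding w(1) G_eq[OF w(2)] gderiv_def f_def prod.case by (simp add: mult_ac)
    show "continuous_on UNIV (\<lambda>\<theta>. G \<theta> w)"
      using grad_continuous[OF w(2), of x] by (simp add: w(1) G_def)
  qed
  have p_meas: "?p \<theta> z \<in> borel_measurable ?M" if "z \<in> space Z" for \<theta> z
  proof (rule borel_measurable_traj_density)
    show "(\<lambda>x. \<mu> \<theta> x t z) \<in> borel_measurable borel" if "t \<in> {1..T}" for t
      using measurable_compose[OF measurable_Pair2'[OF \<open>z \<in> space Z\<close>] mean_measurable[OF that]]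
      by simp
  qed
  have proj: "(\<lambda>x. x 0) \<in> ?M \<rightarrow>\<^sub>M borel"
    using measurable_component_singleton[of 0 "{0..T}" "\<lambda>_. lborel :: (real ^ 'n) measure"]
    by (simp add: lebesgue_on_times_def)
  have lhs: "(\<integral>z. (\<integral>x\<^sub>0. - r x\<^sub>0 z \<partial>sample_law T \<mu> \<Sigma>\<^sub>c \<theta> z) \<partial>Z) = - (\<integral>w. f \<theta> w \<partial>(Z \<Otimes>\<^sub>M ?M))" for \<theta>
  proof -
    \<comment> \<open>The identity holds for every prompt, even where the inner integral fails to
      exist, since both sides are then 0. Integrability enters only with Fubini.\<close>
    have "(\<integral>x\<^sub>0. - r x\<^sub>0 z \<partial>sample_law T \<mu> \<Sigma>\<^sub>c \<theta> z) = - (\<integral>x. f \<theta> (z, x) \<partial>?M)"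
      if z: "z \<in> space Z" for z
    proof -
      note [measurable] = p_meas[OF z] proj
      have r [measurable]: "(\<lambda>x\<^sub>0. r x\<^sub>0 z) \<in> borel_measurable borel"
        using measurable_compose[OF measurable_Pair2'[OF z] reward_measurable] by simp
      have "(\<integral>x\<^sub>0. - r x\<^sub>0 z \<partial>sample_law T \<mu> \<Sigma>\<^sub>c \<theta> z) = (\<integral>x. - r (x 0) z \<partial>traj_law T \<mu> \<Sigma>\<^sub>c \<theta> z)"
        unfolding sample_law_eq_distr[OF p_meas[OF z]]
        by (rule integral_distr) (simp_all add: traj_law_def)
      also have "\<dots> = (\<integral>x. ?p \<theta> z x *\<^sub>R - r (x 0) z \<partial>?M)"
        unfolding traj_law_def
        by (intro integral_density) (auto intro: less_imp_le p_pos)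
      finally show ?thesis
        by (simp add: f_def)
    qed
    then have "(\<integral>z. (\<integral>x\<^sub>0. - r x\<^sub>0 z \<partial>sample_law T \<mu> \<Sigma>\<^sub>c \<theta> z) \<partial>Z) = - (\<integral>z. (\<integral>x. f \<theta> (z, x) \<partial>?M) \<partial>Z)"
      by (simp cong: Bochner_Integration.integral_cong)
    then show ?thesis
      by (simp add: P.integral_fst'[OF f_int])
  qed
  have rhs: "(\<integral>z. (\<integral>x. (- r (x 0) z) *\<^sub>R ?S \<theta> z x \<partial>traj_law T \<mu> \<Sigma>\<^sub>c \<theta> z) \<partial>Z)
      = - (\<integral>w. G \<theta> w \<partial>(Z \<Otimes>\<^sub>M ?M))"
  proof -
    have "(\<integral>x. (- r (x 0) z) *\<^sub>R ?S \<theta> z x \<partial>traj_law T \<mu> \<Sigma>\<^sub>c \<theta> z) = - (\<integral>x. G \<theta> (z, x) \<partial>?M)"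
      if z: "z \<in> space Z" for z
    proof -
      have p_nz: "?p \<theta> z x \<noteq> 0" for x
        using p_pos[of \<mu> \<theta> z x] by simp
      \<comment> \<open>Writing the integrand as a multiple of \<open>G\<close> yields its
        measurability: sections of \<open>G\<close> are measurable because \<open>G\<close> is
        integrable on the product, and the density is measurable as well.\<close>
      have weight: "(- r (x 0) z) *\<^sub>R ?S \<theta> z x = (- 1 / ?p \<theta> z x) *\<^sub>R G \<theta> (z, x)" for x
        by (simp add: G_eq[OF z] p_nz)
      have [measurable]: "(\<lambda>x. G \<theta> (z, x)) \<in> borel_measurable ?M"
        using measurable_compose[OF measurable_Pair1'[OF z] borel_measurable_integrable[OF G_int]] .
      note [measurable] = p_meas[OF z]
      have "(\<integral>x. (- r (x 0) z) *\<^sub>R ?S \<theta> z x \<partial>traj_law T \<mu> \<Sigma>\<^sub>c \<theta> z)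
          = (\<integral>x. ?p \<theta> z x *\<^sub>R (- 1 / ?p \<theta> z x) *\<^sub>R G \<theta> (z, x) \<partial>?M)"
        unfolding traj_law_def weight
        by (intro integral_density) (auto intro: less_imp_le p_pos)
      also have "\<dots> = (\<integral>x. - G \<theta> (z, x) \<partial>?M)"
        by (intro Bochner_Integration.integral_cong) (simp_all add: p_nz)
      finally show ?thesis
        by simp
    qed
    then have "(\<integral>z. (\<integral>x. (- r (x 0) z) *\<^sub>R ?S \<theta> z x \<partial>traj_law T \<mu> \<Sigma>\<^sub>c \<theta> z) \<partial>Z)
        = - (\<integral>z. (\<integral>x. G \<theta> (z, x) \<partial>?M) \<partial>Z)"
      by (simp cong: Bochner_Integration.integral_cong)
    then show ?thesis
      by (simp add: P.integral_fst'[OF G_int])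
  qed
  show "GDERIV (\<lambda>\<theta>'. \<integral>z. (\<integral>x\<^sub>0. - r x\<^sub>0 z \<partial>sample_law T \<mu> \<Sigma>\<^sub>c \<theta>' z) \<partial>Z) \<theta> :>
      (\<integral>z. (\<integral>x. (- r (x 0) z) *\<^sub>R ?S \<theta> z x \<partial>traj_law T \<mu> \<Sigma>\<^sub>c \<theta> z) \<partial>Z)"
    unfolding lhs rhs using has_derivative_minus[OF deriv[unfolded gderiv_def]]
    by (simp add: gderiv_def)
qed

end
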